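(* Suppose $r>1$ and $R=ae_1^\top\in\mathbb{R}^{n\times r}$ is a singular point of $\mathcal{B}_{n,r}$ for some $a\in E^n$. Let $C\in\mathbb{S}^n$, and let $(Y,\lambda_1,\lambda_2)$ be a KKT solution of $$\min\left\{\langle C_P,Y\rangle:\ \langle P^\top\mathrm{diag}(a)P,Y\rangle=0,\ \langle I,Y\rangle=n,\ Y\in\mathbb{S}^{n-1}_+\right\}.\qquad(\ast)$$ (i) If $\langle C_P,Y\rangle=0$, then $aa^\top$ is a global optimal solution of $$\min\left\{\langle C,X\rangle:\ \mathrm{diag}(X)=e,\ Xe=0,\ \langle X,ee^\top\rangle=0,\ X\in\mathbb{S}^n_+\right\}.$$ (ii) If $\langle C_P,Y\rangle<0$ and $Y=HH^\top$ for some $H\in\mathbb{R}^{(n-1)\times(r-1)}$, then $PH$ is an escaping direction at $R=ae_1^\top$ of the problem $\min\{\frac12\langle C,RR^\top\rangle:\ R\in\mathcal{B}_{n,r}\}$.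
   Context: $\mathbb{S}^n$ (resp. $\mathbb{S}^n_+$) is the space of real symmetric (resp. positive semidefinite) $n\times n$ matrices; $\langle\cdot,\cdot\rangle$ and $\|\cdot\|$ are the Frobenius inner product and norm; $e\in\mathbb{R}^n$ is the all-ones vector; $e_1\in\mathbb{R}^r$ is the first standard basis vector; $J:=I-ee^\top/n$. $\mathrm{diag}(X)$ is the diagonal vector of a square matrix, $\mathrm{diag}(x)$ the diagonal matrix of a vector, $\mathrm{Diag}(X)$ the diagonal matrix with the same diagonal as $X$. $\mathcal{B}_{n,r}:=\{R\in\mathbb{R}^{n\times r}:\mathrm{diag}(RR^\top)=e,\ R^\top e=0\}$, $E^n:=\{v\in\{-1,1\}^n:e^\top v=0\}$; the points $ae_1^\top$, $a\in E^n$, are singular points of $\mathcal{B}_{n,r}$. $P\in\mathbb{R}^{n\times(n-1)}$ is a matrix with $P^\top P=I$ and $PP^\top=J$, and $C_P:=P^\top(C-\mathrm{Diag}(Caa^\top))P$. $(Y,\lambda_1,\lambda_2)$ is a KKT solution of $(\ast)$ if $Y$ is feasible, $S:=C_P-\lambda_1I-\lambda_2P^\top\mathrm{diag}(a)P\in\mathbb{S}^{n-1}_+$ and $\langle S,Y\rangle=0$. A matrix $K\in\mathbb{R}^{n\times(r-1)}$ is called an escaping direction of $\min\{\frac12\langle C,RR^\top\rangle:R\in\mathcal{B}_{n,r}\}$ at $R=ae_1^\top$ if $e^\top K=0$, $a^\top\mathrm{diag}(KK^\top)=0$, $\|K\|^2=n$ and $\frac12\langle(C-\mathrm{Diag}(Caa^\top))K,K\rangle<0$.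 *)

theory Defs
  imports "HOL.Real" "Jordan_Normal_Form.Matrix"
begin

definition ones :: "nat \<Rightarrow> real vec" where
  "ones n = vec n (\<lambda>_. 1)"

definition diagv :: "real mat \<Rightarrow> real vec" where
  "diagv X = vec (dim_row X) (\<lambda>i. X $$ (i, i))"

definition diagm :: "real vec \<Rightarrow> real mat" where
  "diagm x = mat_diag (dim_vec x) (\<lambda>i. x $ i)"

definition Diag :: "real mat \<Rightarrow> real mat" where
  "Diag X = diagm (diagv X)"

(* x y^T *)
definition outer :: "real vec \<Rightarrow> real vec \<Rightarrow> real mat" where
  "outer x y = mat (dim_vec x) (dim_vec y) (\<lambda>(i, j). x $ i * y $ j)"

(* Only meant for matrices of equal dimensions; those of the first argument fix the range of summation. *)
definition frob :: "real mat \<Rightarrow> real mat \<Rightarrow> real" where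
  "frob A B = (\<Sum>i<dim_row A. \<Sum>j<dim_col A. A $$ (i, j) * B $$ (i, j))"

definition frob_norm :: "real mat \<Rightarrow> real" where
  "frob_norm A = sqrt (frob A A)"

definition sym_mats :: "nat \<Rightarrow> real mat set" where
  "sym_mats n = {A \<in> carrier_mat n n. transpose_mat A = A}"

definition psd_mats :: "nat \<Rightarrow> real mat set" where
  "psd_mats n = {A \<in> sym_mats n. \<forall>v \<in> carrier_vec n. 0 \<le> v \<bullet> (A *\<^sub>v v)}"

definition centering :: "nat \<Rightarrow> real mat" where
  "centering n = 1\<^sub>m n - (1 / real n) \<cdot>\<^sub>m outer (ones n) (ones n)"

definition \<B> :: "nat \<Rightarrow> nat \<Rightarrow> real mat set" where
  "\<B> n r = {R \<in> carrier_mat n r.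
     diagv (R * transpose_mat R) = ones n \<and> transpose_mat R *\<^sub>v ones n = 0\<^sub>v r}"

definition E :: "nat \<Rightarrow> real vec set" where
  "E n = {v \<in> carrier_vec n. (\<forall>i<n. v $ i \<in> {-1, 1}) \<and> ones n \<bullet> v = 0}"

(* a e_1^T; coordinates are numbered from 0, so e_1 is unit_vec r 0 *)
definition singular_pt :: "nat \<Rightarrow> real vec \<Rightarrow> real mat" where
  "singular_pt r a = outer a (unit_vec r 0)"

definition shifted :: "real mat \<Rightarrow> real vec \<Rightarrow> real mat" where
  "shifted C a = C - Diag (C * outer a a)"

definition compressed :: "real mat \<Rightarrow> real mat \<Rightarrow> real vec \<Rightarrow> real mat" where
  "compressed P C a = transpose_mat P * shifted C a * P"

definition sub_feasible :: "nat \<Rightarrow> real mat \<Rightarrow> real vec \<Rightarrow> real mat set" where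
  "sub_feasible n P a = {Y \<in> psd_mats (n - 1).
     frob (transpose_mat P * diagm a * P) Y = 0 \<and> frob (1\<^sub>m (n - 1)) Y = real n}"

(* KKT solution of  min {frob (compressed P C a) Y | Y \<in> sub_feasible n P a} *)
definition kkt_solution ::
  "nat \<Rightarrow> real mat \<Rightarrow> real mat \<Rightarrow> real vec \<Rightarrow> real mat \<Rightarrow> real \<Rightarrow> real \<Rightarrow> bool" where
  "kkt_solution n P C a Y l1 l2 \<longleftrightarrow>
     Y \<in> sub_feasible n P a \<and>
     (let S = compressed P C a - l1 \<cdot>\<^sub>m 1\<^sub>m (n - 1) - l2 \<cdot>\<^sub>m (transpose_mat P * diagm a * P)
      in S \<in> psd_mats (n - 1) \<and> frob S Y = 0)"

definition sdp_feasible :: "nat \<Rightarrow> real mat set" where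
  "sdp_feasible n = {X \<in> psd_mats n.
     diagv X = ones n \<and> X *\<^sub>v ones n = 0\<^sub>v n \<and> frob X (outer (ones n) (ones n)) = 0}"

(* Escaping direction K of  min {1/2 frob C (R * R^T) | R \<in> \<B> n r}  at a point R = a e_1^T;
   for r > 0 the vector a is determined by R. *)
definition escaping_direction ::
  "nat \<Rightarrow> nat \<Rightarrow> real mat \<Rightarrow> real mat \<Rightarrow> real mat \<Rightarrow> bool" where
  "escaping_direction n r C R K \<longleftrightarrow>
     K \<in> carrier_mat n (r - 1) \<and>
     (\<exists>a \<in> E n. R = singular_pt r a \<and>
        transpose_mat K *\<^sub>v ones n = 0\<^sub>v (r - 1) \<and>
        a \<bullet> diagv (K * transpose_mat K) = 0 \<and>
        (frob_norm K)\<^sup>2 = real n \<and>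
        1 / 2 * frob (shifted C a * K) K < 0)"

end

theory Submission
  imports Defs
begin

text \<open>
  Pairing the dual slack \<open>S\<close> with \<open>Y\<close> turns the complementarity condition into
  \<open>\<langle>C\<^sub>P, Y\<rangle> = \<lambda>\<^sub>1 n\<close>, because \<open>Y\<close> has trace \<open>n\<close> and is orthogonal to
  \<open>P\<^sup>T diag(a) P\<close>. Since \<open>n \<ge> 1\<close>, the sign of the value is
  the sign of \<open>\<lambda>\<^sub>1\<close>.

  If the value is zero, then \<open>\<lambda>\<^sub>1 = 0\<close>, and \<open>P\<^sup>T M P\<close> is positive semidefinite for
  \<open>M = C - Diag(C a a\<^sup>T) - \<lambda>\<^sub>2 diag(a)\<close>; this \<open>M\<close> is a dual certificate for \<open>a a\<^sup>T\<close>.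
  On a feasible \<open>X\<close> of the large problem the two diagonal terms of \<open>M\<close> are constant, so that
  \<open>\<langle>M, X\<rangle> = \<langle>C, X\<rangle> - \<langle>C, a a\<^sup>T\<rangle>\<close> (\<open>frob_shifted\<close>). On the other hand \<open>X e = 0\<close> gives
  \<open>X = P (P\<^sup>T X P) P\<^sup>T\<close>, hence \<open>\<langle>M, X\<rangle> = \<langle>P\<^sup>T M P, P\<^sup>T X P\<rangle>\<close>, which is nonnegative because
  the cone of positive semidefinite matrices is self-dual (\<open>frob_psd_nonneg\<close>).

  If the value is negative and \<open>Y = H H\<^sup>T\<close>, then every requirement on the direction \<open>P H\<close>
  is a feasibility condition of \<open>Y\<close>, or the sign of its value, moved through the adjointness relation
  \<open>\<langle>P\<^sup>T M P, Y\<rangle> = \<langle>M, P Y P\<^sup>T\<rangle>\<close> (\<open>frob_congruence\<close>).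
\<close>

section \<open>The Frobenius inner product\<close>

lemma frob_minus_left:
  assumes "A \<in> carrier_mat n m" "B \<in> carrier_mat n m"
  shows "frob (A - B) X = frob A X - frob B X"
  using assms by (simp add: frob_def left_diff_distrib sum_subtractf)

lemma frob_smult_left: "frob (c \<cdot>\<^sub>m A) X = c * frob A X"
  by (simp add: frob_def sum_distrib_left mult.assoc)

lemma frob_commute:
  assumes "A \<in> carrier_mat n m" "B \<in> carrier_mat n m"
  shows "frob A B = frob B A"
  using assms by (simp add: frob_def mult.commute)

lemma frob_mult_adjoint_right:
  assumes "A \<in> carrier_mat n k" "B \<in> carrier_mat k m" "X \<in> carrier_mat n m"
  shows "frob (A * B) X = frob A (X * transpose_mat B)"
proof -
  have "(\<Sum>j<m. (\<Sum>l<k. A $$ (i, l) * B $$ (l, j)) * X $$ (i, j)) =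
        (\<Sum>l<k. A $$ (i, l) * (\<Sum>j<m. X $$ (i, j) * B $$ (l, j)))" for i
    unfolding sum_distrib_left sum_distrib_right
    by (subst sum.swap) (simp add: mult_ac)
  then show ?thesis
    using assms by (simp add: frob_def scalar_prod_def atLeast0LessThan)
qed

lemma frob_mult_adjoint_left:
  assumes "A \<in> carrier_mat k n" "B \<in> carrier_mat k m" "X \<in> carrier_mat n m"
  shows "frob (transpose_mat A * B) X = frob B (A * X)"
proof -
  have "(\<Sum>i<n. \<Sum>j<m. (\<Sum>l<k. A $$ (l, i) * B $$ (l, j)) * X $$ (i, j)) =
        (\<Sum>i<n. \<Sum>j<m. \<Sum>l<k. B $$ (l, j) * (A $$ (l, i) * X $$ (i, j)))"
    unfolding sum_distrib_right by (simp add: mult_ac)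
  also have "\<dots> = (\<Sum>i<n. \<Sum>l<k. \<Sum>j<m. B $$ (l, j) * (A $$ (l, i) * X $$ (i, j)))"
    by (intro sum.cong refl sum.swap)
  also have "\<dots> = (\<Sum>l<k. \<Sum>i<n. \<Sum>j<m. B $$ (l, j) * (A $$ (l, i) * X $$ (i, j)))"
    by (rule sum.swap)
  also have "\<dots> = (\<Sum>l<k. \<Sum>j<m. \<Sum>i<n. B $$ (l, j) * (A $$ (l, i) * X $$ (i, j)))"
    by (intro sum.cong refl sum.swap)
  finally show ?thesis
    using assms by (simp add: frob_def scalar_prod_def atLeast0LessThan sum_distrib_left)
qed

lemma frob_congruence:
  assumes "M \<in> carrier_mat n n" "P \<in> carrier_mat n k" "Y \<in> carrier_mat k k"
  shows "frob (transpose_mat P * M * P) Y = frob M (P * Y * transpose_mat P)"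
proof -
  have "frob (transpose_mat P * M * P) Y = frob (transpose_mat P * M) (Y * transpose_mat P)"
    using assms by (intro frob_mult_adjoint_right) auto
  also have "\<dots> = frob M (P * (Y * transpose_mat P))"
    using assms by (intro frob_mult_adjoint_left) auto
  finally show ?thesis
    using assms by (simp add: assoc_mult_mat[of _ n k _ k _ n])
qed

lemma frob_outer:
  assumes "A \<in> carrier_mat n n" "x \<in> carrier_vec n"
  shows "frob A (outer x x) = x \<bullet> (A *\<^sub>v x)"
  using assms
  by (simp add: frob_def outer_def scalar_prod_def atLeast0LessThan sum_distrib_left mult_ac)

lemma frob_outer_outer:
  assumes "x \<in> carrier_vec n" "v \<in> carrier_vec n"
  shows "frob (outer x x) (outer v v) = (v \<bullet> x)\<^sup>2"
  using assms
  by (simp add: frob_def outer_def scalar_prod_def atLeast0LessThan power2_eq_square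
      sum_product mult_ac)

lemma diagm_carrier [simp]: "x \<in> carrier_vec n \<Longrightarrow> diagm x \<in> carrier_mat n n"
  by (simp add: diagm_def)

lemma diagv_carrier [simp]: "A \<in> carrier_mat n m \<Longrightarrow> diagv A \<in> carrier_vec n"
  by (simp add: diagv_def)

lemma outer_carrier [simp]:
  "x \<in> carrier_vec n \<Longrightarrow> y \<in> carrier_vec m \<Longrightarrow> outer x y \<in> carrier_mat n m"
  by (simp add: outer_def)

lemma ones_carrier [simp]: "ones n \<in> carrier_vec n"
  by (simp add: ones_def)

lemma frob_diagm:
  assumes "x \<in> carrier_vec n" "X \<in> carrier_mat n n"
  shows "frob (diagm x) X = x \<bullet> diagv X"
proof -
  have "(\<Sum>j<n. (if i = j then x $ j else 0) * X $$ (i, j)) = x $ i * X $$ (i, i)"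
    if "i < n" for i
    using that by (simp add: if_distrib[of "\<lambda>c. c * _"] cong: if_cong)
  then show ?thesis
    using assms
    by (simp add: frob_def diagm_def diagv_def mat_diag_def scalar_prod_def atLeast0LessThan)
qed

section \<open>Self-duality of the positive semidefinite cone\<close>

lemma psd_carrier: "A \<in> psd_mats n \<Longrightarrow> A \<in> carrier_mat n n"
  by (simp add: psd_mats_def sym_mats_def)

lemma psd_symmetric: "A \<in> psd_mats n \<Longrightarrow> transpose_mat A = A"
  by (simp add: psd_mats_def sym_mats_def)

lemma psd_quadratic_nonneg:
  "A \<in> psd_mats n \<Longrightarrow> v \<in> carrier_vec n \<Longrightarrow> 0 \<le> v \<bullet> (A *\<^sub>v v)"
  by (simp add: psd_mats_def)

lemma symmetric_entry:
  assumes "A \<in> carrier_mat n n" "transpose_mat A = A" "i < n" "j < n"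
  shows "A $$ (i, j) = A $$ (j, i)"
  using assms by (metis carrier_matD index_transpose_mat(1))

lemma mult_unit_vec:
  assumes "A \<in> carrier_mat n n" "i < n"
  shows "A *\<^sub>v (unit_vec n i :: real vec) = col A i"
  using assms by (intro eq_vecI) auto

lemma scalar_prod_symmetric_mult:
  assumes "A \<in> carrier_mat n n" "transpose_mat A = (A :: real mat)"
    "v \<in> carrier_vec n" "w \<in> carrier_vec n"
  shows "v \<bullet> (A *\<^sub>v w) = w \<bullet> (A *\<^sub>v v)"
  using assms transpose_vec_mult_scalar[of A n n w v]
  by (simp add: comm_scalar_prod[of _ n])

lemma quadratic_shift:
  assumes A: "A \<in> carrier_mat n n" "transpose_mat A = (A :: real mat)"
    and v: "v \<in> carrier_vec n" and i: "i < n"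
  shows "(v + t \<cdot>\<^sub>v unit_vec n i) \<bullet> (A *\<^sub>v (v + t \<cdot>\<^sub>v unit_vec n i)) =
         v \<bullet> (A *\<^sub>v v) + 2 * t * (v \<bullet> col A i) + t\<^sup>2 * A $$ (i, i)"
proof -
  have c: "col A i \<in> carrier_vec n" and Av: "A *\<^sub>v v \<in> carrier_vec n"
    using A v by auto
  have "unit_vec n i \<bullet> (A *\<^sub>v v) = v \<bullet> col A i"
    using scalar_prod_symmetric_mult[OF A unit_vec_carrier v] mult_unit_vec[OF A(1) i] by simp
  moreover have "unit_vec n i \<bullet> col A i = A $$ (i, i)"
    using A i by simp
  ultimately show ?thesis
    using A v c Av i
    by (simp add: mult_add_distrib_mat_vec[of _ n n] mult_mat_vec[of _ n n] mult_unit_vec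
        scalar_prod_add_distrib[of _ n] add_scalar_prod_distrib[of _ n] power2_eq_square
        algebra_simps)
qed

lemma psd_diag_nonneg:
  assumes "A \<in> psd_mats n" "i < n"
  shows "0 \<le> A $$ (i, i)"
  using quadratic_shift[OF psd_carrier psd_symmetric, OF assms(1) assms(1) zero_carrier_vec assms(2),
      of 1] psd_quadratic_nonneg[OF assms(1), of "0\<^sub>v n + 1 \<cdot>\<^sub>v unit_vec n i"]
    psd_carrier[OF assms(1)] assms(2)
  by simp

lemma psd_zero_diag_eq_zero:
  assumes A: "A \<in> psd_mats n" and z: "\<And>i. i < n \<Longrightarrow> A $$ (i, i) = 0"
  shows "A = 0\<^sub>m n n"
proof (rule eq_matI)
  fix i j assume "i < dim_row (0\<^sub>m n n :: real mat)" "j < dim_col (0\<^sub>m n n :: real mat)"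
  then have i: "i < n" and j: "j < n" by auto
  have Ac: "A \<in> carrier_mat n n" using A by (rule psd_carrier)
  (* The form takes the value 2 t A_ij at e_i + t e_j; the signs t = 1 and t = -1 force A_ij = 0. *)
  have "0 \<le> 2 * t * A $$ (i, j)" for t
  proof -
    have "0 \<le> (unit_vec n i + t \<cdot>\<^sub>v unit_vec n j) \<bullet> (A *\<^sub>v (unit_vec n i + t \<cdot>\<^sub>v unit_vec n j))"
      using A by (intro psd_quadratic_nonneg) auto
    also have "\<dots> = unit_vec n i \<bullet> (A *\<^sub>v unit_vec n i) + 2 * t * (unit_vec n i \<bullet> col A j)"
      using quadratic_shift[OF Ac psd_symmetric[OF A] unit_vec_carrier j] z[OF j] by simp
    also have "\<dots> = 2 * t * A $$ (i, j)"
      using Ac i j z[OF i] by (simp add: mult_unit_vec)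
    finally show ?thesis .
  qed
  from this[of 1] this[of "-1"] show "A $$ (i, j) = 0\<^sub>m n n $$ (i, j)"
    using i j by simp
qed (use psd_carrier[OF A] in auto)

text \<open>
  The Schur complement with respect to a positive pivot is the minimum of the quadratic form along
  the pivot direction, so it inherits nonnegativity.
\<close>
lemma psd_schur_complement:
  assumes A: "A \<in> psd_mats n" and i: "i < n" and pos: "A $$ (i, i) > 0"
  shows "A - (1 / A $$ (i, i)) \<cdot>\<^sub>m outer (col A i) (col A i) \<in> psd_mats n"
proof -
  let ?c = "col A i" and ?p = "A $$ (i, i)"
  let ?B = "A - (1 / ?p) \<cdot>\<^sub>m outer ?c ?c"
  have Ac: "A \<in> carrier_mat n n" and sym: "transpose_mat A = A"
    using A by (simp_all add: psd_carrier psd_symmetric)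
  have c: "?c \<in> carrier_vec n" using Ac by auto
  have Bc: "?B \<in> carrier_mat n n"
    using c by (intro minus_carrier_mat smult_carrier_mat outer_carrier)
  have "transpose_mat ?B = ?B"
    using Ac symmetric_entry[OF Ac sym] by (intro eq_matI) (auto simp: outer_def)
  moreover have "0 \<le> v \<bullet> (?B *\<^sub>v v)" if v: "v \<in> carrier_vec n" for v
  proof -
    (* t minimises the form of A on the line through v in direction e_i. *)
    define t where "t = - (v \<bullet> ?c) / ?p"
    let ?w = "v + t \<cdot>\<^sub>v unit_vec n i"
    have o: "frob (outer ?c ?c) (outer v v) = (v \<bullet> ?c)\<^sup>2"
      using c v by (rule frob_outer_outer)
    have "v \<bullet> (?B *\<^sub>v v) = v \<bullet> (A *\<^sub>v v) - (v \<bullet> ?c)\<^sup>2 / ?p"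
      using Ac Bc c v o frob_minus_left[of A n n "(1 / ?p) \<cdot>\<^sub>m outer ?c ?c"]
      by (simp flip: frob_outer add: frob_smult_left)
    also have "\<dots> = ?w \<bullet> (A *\<^sub>v ?w)"
      unfolding quadratic_shift[OF Ac sym v i] t_def
      using pos by (simp add: power2_eq_square field_simps)
    also have "\<dots> \<ge> 0"
      using A v by (intro psd_quadratic_nonneg) auto
    finally show ?thesis .
  qed
  ultimately show ?thesis
    using Bc by (simp add: psd_mats_def sym_mats_def)
qed

text \<open>
  Symmetric Gaussian elimination on \<open>Z\<close> replaces the spectral theorem: each step splits off a
  positive multiple of some \<open>c c\<^sup>T\<close>, on which the pairing with \<open>S\<close> is a value of the quadratic form
  of \<open>S\<close>, and leaves a positive semidefinite matrix with fewer nonzero diagonal entries.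
\<close>
lemma frob_psd_nonneg:
  assumes S: "S \<in> psd_mats n" and "Z \<in> psd_mats n"
  shows "0 \<le> frob S Z"
  using assms(2)
proof (induction "card {i. i < n \<and> Z $$ (i, i) \<noteq> 0}" arbitrary: Z rule: less_induct)
  case less
  note Z = less.prems
  have Sc: "S \<in> carrier_mat n n" and Zc: "Z \<in> carrier_mat n n"
    using S Z by (simp_all add: psd_carrier)
  show ?case
  proof (cases "\<forall>i<n. Z $$ (i, i) = 0")
    case True
    then have "Z = 0\<^sub>m n n" using Z by (intro psd_zero_diag_eq_zero) auto
    then show ?thesis using Sc by (simp add: frob_def)
  next
    case False
    then obtain i where i: "i < n" and "Z $$ (i, i) \<noteq> 0" by auto
    then have pos: "Z $$ (i, i) > 0" using psd_diag_nonneg[OF Z i] by simp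
    let ?c = "col Z i" and ?p = "Z $$ (i, i)"
    define Z' where "Z' = Z - (1 / ?p) \<cdot>\<^sub>m outer ?c ?c"
    have c: "?c \<in> carrier_vec n" using Zc by auto
    have Z': "Z' \<in> psd_mats n"
      unfolding Z'_def using Z i pos by (rule psd_schur_complement)
    have entry: "Z' $$ (j, j) = Z $$ (j, j) - (Z $$ (j, i))\<^sup>2 / ?p" if "j < n" for j
      using that Zc i by (simp add: Z'_def outer_def power2_eq_square)
    have "Z' $$ (i, i) = 0" using entry[OF i] pos by (simp add: power2_eq_square)
    (* A vanishing diagonal entry stays zero, since the elimination can only decrease it
       and the diagonal of Z' is nonnegative. *)
    moreover have "Z' $$ (j, j) = 0" if "j < n" "Z $$ (j, j) = 0" for j
      using entry[OF that(1)] that psd_diag_nonneg[OF Z' that(1)] pos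
      by (simp add: zero_le_divide_iff divide_le_0_iff)
    ultimately have "{j. j < n \<and> Z' $$ (j, j) \<noteq> 0} \<subset> {j. j < n \<and> Z $$ (j, j) \<noteq> 0}"
      using i pos by auto
    then have "card {j. j < n \<and> Z' $$ (j, j) \<noteq> 0} < card {j. j < n \<and> Z $$ (j, j) \<noteq> 0}"
      by (intro psubset_card_mono) auto
    then have IH: "0 \<le> frob S Z'" using less.hyps Z' by blast
    have "frob S Z' = frob S Z - (1 / ?p) * frob S (outer ?c ?c)"
    proof -
      have oc: "outer ?c ?c \<in> carrier_mat n n" using c by simp
      have "frob S Z' = frob Z' S"
        using Sc Z' by (simp add: frob_commute[of _ n n] psd_carrier)
      also have "\<dots> = frob Z S - (1 / ?p) * frob (outer ?c ?c) S"
        unfolding Z'_def using Zc oc by (simp add: frob_minus_left[of _ n n] frob_smult_left)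
      finally show ?thesis
        using Sc Zc oc by (simp add: frob_commute[of _ n n S])
    qed
    moreover have "0 \<le> (1 / ?p) * frob S (outer ?c ?c)"
      using pos psd_quadratic_nonneg[OF S c] frob_outer[OF Sc c] by simp
    ultimately show ?thesis using IH by linarith
  qed
qed

lemma psd_congruence:
  assumes X: "X \<in> psd_mats n" and P: "P \<in> carrier_mat n k"
  shows "transpose_mat P * X * P \<in> psd_mats k"
proof -
  have Xc: "X \<in> carrier_mat n n" and sym: "transpose_mat X = X"
    using X by (simp_all add: psd_carrier psd_symmetric)
  have "transpose_mat (transpose_mat P * X * P) = transpose_mat P * X * P"
    using Xc P sym
    by (simp add: transpose_mult[of "transpose_mat P" k n "X * P" k] transpose_mult[of X n n P k]
        assoc_mult_mat[of _ k n _ n _ k])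
  moreover have "0 \<le> v \<bullet> (transpose_mat P * X * P *\<^sub>v v)" if v: "v \<in> carrier_vec k" for v
  proof -
    have "v \<bullet> (transpose_mat P * X * P *\<^sub>v v) = v \<bullet> (transpose_mat P *\<^sub>v (X *\<^sub>v (P *\<^sub>v v)))"
      using Xc P v by (simp add: assoc_mult_mat_vec[of _ k n _ k] assoc_mult_mat_vec[of _ k n _ n])
    also have "\<dots> = (P *\<^sub>v v) \<bullet> (X *\<^sub>v (P *\<^sub>v v))"
      using transpose_vec_mult_scalar[OF P v, of "X *\<^sub>v (P *\<^sub>v v)"] Xc P v
      by (simp add: comm_scalar_prod[of _ k] comm_scalar_prod[of _ n])
    also have "\<dots> \<ge> 0"
      using X P v by (intro psd_quadratic_nonneg) auto
    finally show ?thesis .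
  qed
  ultimately show ?thesis
    using Xc P by (simp add: psd_mats_def sym_mats_def)
qed

section \<open>The centering projection\<close>

lemma centering_carrier [simp]: "centering n \<in> carrier_mat n n"
  unfolding centering_def by (intro minus_carrier_mat smult_carrier_mat outer_carrier ones_carrier)

lemma centering_symmetric: "transpose_mat (centering n) = centering n"
  by (rule eq_matI) (auto simp: centering_def outer_def ones_def)

lemma centering_mult_ones: "n \<ge> 1 \<Longrightarrow> centering n *\<^sub>v ones n = 0\<^sub>v n"
  by (rule eq_vecI)
     (auto simp: centering_def outer_def ones_def scalar_prod_def sum_subtractf)

lemma mult_zero_vec:
  assumes "A \<in> carrier_mat n m"
  shows "A *\<^sub>v 0\<^sub>v m = (0\<^sub>v n :: real vec)"
  using assms by (intro eq_vecI) auto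

lemma mult_centering:
  assumes X: "X \<in> carrier_mat n n" and e: "X *\<^sub>v ones n = 0\<^sub>v n"
  shows "X * centering n = X"
proof -
  have row_sum: "(\<Sum>k<n. X $$ (i, k)) = 0" if "i < n" for i
    using arg_cong[OF e, of "\<lambda>v. v $ i"] that X
    by (simp add: ones_def scalar_prod_def atLeast0LessThan)
  have "X * outer (ones n) (ones n) = 0\<^sub>m n n"
    using X row_sum
    by (intro eq_matI) (auto simp: outer_def ones_def scalar_prod_def atLeast0LessThan)
  then show ?thesis
    using X unfolding centering_def
    by (simp add: mult_minus_distrib_mat[of _ n n _ n] mult_smult_distrib[of _ n n _ n])
       (rule eq_matI, auto)
qed

lemma centering_conjugation:
  assumes X: "X \<in> carrier_mat n n" "transpose_mat X = X" and e: "X *\<^sub>v ones n = 0\<^sub>v n"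
  shows "centering n * X * centering n = X"
proof -
  have "centering n * X = transpose_mat (X * centering n)"
    using X by (simp add: transpose_mult[of _ n n _ n] centering_symmetric)
  also have "\<dots> = X" using mult_centering[OF X(1) e] X(2) by simp
  finally show ?thesis using mult_centering[OF X(1) e] by simp
qed

section \<open>The certificate and the direction\<close>

lemma Diag_carrier [simp]: "A \<in> carrier_mat n m \<Longrightarrow> Diag A \<in> carrier_mat n n"
  unfolding Diag_def by (intro diagm_carrier diagv_carrier)

lemma shifted_carrier [simp]:
  assumes "C \<in> carrier_mat n n" "a \<in> carrier_vec n"
  shows "shifted C a \<in> carrier_mat n n"
  unfolding shifted_def
  using assms by (intro minus_carrier_mat Diag_carrier mult_carrier_mat outer_carrier)

text \<open>
  The subtracted matrix is diagonal, so its pairing with \<open>X\<close> sees only the diagonal of \<open>X\<close>; when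
  that is constant one, the pairing is the trace of \<open>C a a\<^sup>T\<close>, the objective value at \<open>a a\<^sup>T\<close>.
\<close>
lemma frob_shifted:
  assumes C: "C \<in> carrier_mat n n" and a: "a \<in> carrier_vec n" and X: "X \<in> carrier_mat n n"
    and d: "diagv X = ones n"
  shows "frob (shifted C a) X = frob C X - frob C (outer a a)"
proof -
  have CA: "C * outer a a \<in> carrier_mat n n"
    using C a by (intro mult_carrier_mat outer_carrier)
  note D = diagv_carrier[OF CA]
  have "frob (Diag (C * outer a a)) X = diagv (C * outer a a) \<bullet> ones n"
    using frob_diagm[OF D X] d by (simp add: Diag_def)
  also have "\<dots> = frob C (outer a a)"
    using C a by (simp add: frob_def outer_def diagv_def ones_def scalar_prod_def atLeast0LessThan mult_ac)
  finally show ?thesis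
    unfolding shifted_def frob_minus_left[OF C Diag_carrier[OF CA]] by simp
qed

lemma rank_one_sdp_feasible:
  assumes "a \<in> E n"
  shows "outer a a \<in> sdp_feasible n"
proof -
  have a: "a \<in> carrier_vec n" and sq: "\<And>i. i < n \<Longrightarrow> a $ i * a $ i = 1"
    and "ones n \<bullet> a = 0"
    using assms by (force simp: E_def)+
  then have s: "(\<Sum>i<n. a $ i) = 0"
    by (simp add: ones_def scalar_prod_def atLeast0LessThan)
  have "transpose_mat (outer a a) = outer a a"
    using a by (intro eq_matI) (auto simp: outer_def)
  moreover have "0 \<le> v \<bullet> (outer a a *\<^sub>v v)" if v: "v \<in> carrier_vec n" for v
  proof -
    have "v \<bullet> (outer a a *\<^sub>v v) = (v \<bullet> a)\<^sup>2"
      using frob_outer[OF outer_carrier[OF a a] v] frob_outer_outer[OF a v] by simp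
    then show ?thesis by simp
  qed
  moreover have "diagv (outer a a) = ones n"
    using a sq by (intro eq_vecI) (auto simp: outer_def diagv_def ones_def)
  moreover have "outer a a *\<^sub>v ones n = 0\<^sub>v n"
    using a s by (intro eq_vecI)
      (auto simp: outer_def ones_def scalar_prod_def atLeast0LessThan simp flip: sum_distrib_left)
  moreover have "frob (outer a a) (outer (ones n) (ones n)) = 0"
    using a s by (simp add: frob_def outer_def ones_def flip: sum_distrib_left)
  ultimately show ?thesis
    using a by (simp add: sdp_feasible_def psd_mats_def sym_mats_def)
qed

lemma kkt_value:
  assumes C: "C \<in> carrier_mat n n" and a: "a \<in> carrier_vec n" and P: "P \<in> carrier_mat n (n - 1)"
    and kkt: "kkt_solution n P C a Y l1 l2"
  shows "frob (compressed P C a) Y = l1 * real n"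
proof -
  let ?D = "transpose_mat P * diagm a * P"
  have c: "compressed P C a \<in> carrier_mat (n - 1) (n - 1)" "?D \<in> carrier_mat (n - 1) (n - 1)"
    using C a P by (auto simp: compressed_def)
  have "frob (compressed P C a - l1 \<cdot>\<^sub>m 1\<^sub>m (n - 1) - l2 \<cdot>\<^sub>m ?D) Y = 0"
    and "frob ?D Y = 0" and "frob (1\<^sub>m (n - 1)) Y = real n"
    using kkt by (simp_all add: kkt_solution_def sub_feasible_def Let_def)
  moreover have "frob (compressed P C a - l1 \<cdot>\<^sub>m 1\<^sub>m (n - 1) - l2 \<cdot>\<^sub>m ?D) Y =
      frob (compressed P C a - l1 \<cdot>\<^sub>m 1\<^sub>m (n - 1)) Y - frob (l2 \<cdot>\<^sub>m ?D) Y"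
    using c by (intro frob_minus_left[of _ "n - 1" "n - 1"] minus_carrier_mat smult_carrier_mat) auto
  moreover have "frob (compressed P C a - l1 \<cdot>\<^sub>m 1\<^sub>m (n - 1)) Y =
      frob (compressed P C a) Y - frob (l1 \<cdot>\<^sub>m 1\<^sub>m (n - 1)) Y"
    using c by (intro frob_minus_left[of _ "n - 1" "n - 1"]) auto
  ultimately show ?thesis by (simp add: frob_smult_left)
qed

text \<open>
  Weak duality with multiplier zero for the trace constraint; the remaining multiplier
  \<open>l2\<close> drops out of the objective because \<open>a\<close> sums to zero.
\<close>
lemma rank_one_optimal:
  assumes aE: "a \<in> E n" and C: "C \<in> carrier_mat n n" and P: "P \<in> carrier_mat n (n - 1)"
    and PP: "P * transpose_mat P = centering n"
    and S: "compressed P C a - l2 \<cdot>\<^sub>m (transpose_mat P * diagm a * P) \<in> psd_mats (n - 1)"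
    and X: "X \<in> sdp_feasible n"
  shows "frob C (outer a a) \<le> frob C X"
proof -
  let ?D = "transpose_mat P * diagm a * P" and ?Y = "transpose_mat P * X * P"
  have a: "a \<in> carrier_vec n" and ae: "a \<bullet> ones n = 0"
    using aE comm_scalar_prod[of a n "ones n"] by (auto simp: E_def)
  have Xp: "X \<in> psd_mats n" and d: "diagv X = ones n" and e: "X *\<^sub>v ones n = 0\<^sub>v n"
    using X by (auto simp: sdp_feasible_def)
  note Xc = psd_carrier[OF Xp]
  have Pt: "transpose_mat P \<in> carrier_mat (n - 1) n" using P by simp
  have Yc: "?Y \<in> carrier_mat (n - 1) (n - 1)" using P Xc by auto
  have "P * ?Y * transpose_mat P = (P * transpose_mat P) * X * (P * transpose_mat P)"
  proof -
    have "P * ?Y = (P * transpose_mat P) * X * P"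
      using P Pt Xc by (simp add: assoc_mult_mat[of _ n "n - 1" _ n _ n]
          assoc_mult_mat[of _ n "n - 1" _ n _ "n - 1"] assoc_mult_mat[of _ "n - 1" n _ n _ "n - 1"]
          assoc_mult_mat[of _ n n _ n _ "n - 1"])
    then show ?thesis
      using P Pt Xc by (simp add: assoc_mult_mat[of _ n n _ "n - 1" _ n])
  qed
  then have recover: "P * ?Y * transpose_mat P = X"
    using PP centering_conjugation[OF Xc psd_symmetric[OF Xp] e] by simp
  have "0 \<le> frob (compressed P C a - l2 \<cdot>\<^sub>m ?D) ?Y"
    using frob_psd_nonneg[OF S psd_congruence[OF Xp P]] .
  also have "\<dots> = frob (compressed P C a) ?Y - l2 * frob ?D ?Y"
  proof -
    have "compressed P C a \<in> carrier_mat (n - 1) (n - 1)" "?D \<in> carrier_mat (n - 1) (n - 1)"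
      using C a P by (auto simp: compressed_def)
    then show ?thesis by (simp add: frob_minus_left[of _ "n - 1" "n - 1"] frob_smult_left)
  qed
  also have "frob (compressed P C a) ?Y = frob (shifted C a) X"
    unfolding compressed_def frob_congruence[OF shifted_carrier[OF C a] P Yc] recover ..
  also have "frob ?D ?Y = a \<bullet> ones n"
    unfolding frob_congruence[OF diagm_carrier[OF a] P Yc] recover
    using frob_diagm[OF a Xc] d by simp
  finally show ?thesis
    using frob_shifted[OF C a Xc d] ae by simp
qed

lemma escaping_direction_of_factor:
  assumes n: "n \<ge> 1" and aE: "a \<in> E n" and C: "C \<in> carrier_mat n n"
    and P: "P \<in> carrier_mat n (n - 1)"
    and PtP: "transpose_mat P * P = 1\<^sub>m (n - 1)" and PP: "P * transpose_mat P = centering n"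
    and H: "H \<in> carrier_mat (n - 1) (r - 1)"
    and Y: "H * transpose_mat H \<in> sub_feasible n P a"
    and neg: "frob (compressed P C a) (H * transpose_mat H) < 0"
  shows "escaping_direction n r C (singular_pt r a) (P * H)"
proof -
  let ?K = "P * H" and ?Y = "H * transpose_mat H"
  have a: "a \<in> carrier_vec n" using aE by (simp add: E_def)
  have Kc: "?K \<in> carrier_mat n (r - 1)" and Yc: "?Y \<in> carrier_mat (n - 1) (n - 1)"
    and Pt: "transpose_mat P \<in> carrier_mat (n - 1) n"
    and Ht: "transpose_mat H \<in> carrier_mat (r - 1) (n - 1)"
    using P H by auto
  have KKt: "?K * transpose_mat ?K = P * ?Y * transpose_mat P"
    using P H Pt Ht
    by (simp add: transpose_mult[OF P H] assoc_mult_mat[of _ n "n - 1" _ "r - 1" _ n]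
        assoc_mult_mat[of _ "n - 1" "r - 1" _ "n - 1" _ n]
        assoc_mult_mat[of _ n "n - 1" _ "n - 1" _ n])
  (* The kernel of P^T contains that of P P^T, the centering projection. *)
  have "transpose_mat P *\<^sub>v ones n = transpose_mat P * P * transpose_mat P *\<^sub>v ones n"
    using Pt by (simp add: PtP)
  also have "\<dots> = transpose_mat P *\<^sub>v (P * transpose_mat P *\<^sub>v ones n)"
    using P Pt by (simp add: assoc_mult_mat[of _ "n - 1" n _ "n - 1" _ n]
        assoc_mult_mat_vec[of _ "n - 1" n _ n])
  also have "\<dots> = 0\<^sub>v (n - 1)"
    using Pt by (simp add: PP centering_mult_ones[OF n] mult_zero_vec)
  finally have "transpose_mat ?K *\<^sub>v ones n = 0\<^sub>v (r - 1)"
    using H Pt Ht by (simp add: transpose_mult[OF P H] assoc_mult_mat_vec[of _ "r - 1" "n - 1" _ n]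
        mult_zero_vec)
  moreover have "a \<bullet> diagv (?K * transpose_mat ?K) = 0"
  proof -
    have "a \<bullet> diagv (?K * transpose_mat ?K) = frob (diagm a) (P * ?Y * transpose_mat P)"
      using frob_diagm[OF a] Kc KKt by (metis mult_carrier_mat transpose_carrier_mat)
    also have "\<dots> = 0"
      using frob_congruence[OF diagm_carrier[OF a] P Yc] Y by (simp add: sub_feasible_def)
    finally show ?thesis .
  qed
  moreover have "(frob_norm ?K)\<^sup>2 = real n"
  proof -
    have "frob ?K ?K = frob H (transpose_mat P * ?K)"
      using frob_mult_adjoint_left[of "transpose_mat P" "n - 1" n H "r - 1" ?K] P H Kc by simp
    also have "transpose_mat P * ?K = H"
      using P H Pt PtP by (simp flip: assoc_mult_mat[of _ "n - 1" n _ "n - 1" _ "r - 1"])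
    also have "frob H H = frob (1\<^sub>m (n - 1)) ?Y"
      using frob_mult_adjoint_right[of "1\<^sub>m (n - 1)" "n - 1" "n - 1" H "r - 1" H] H by simp
    also have "\<dots> = real n" using Y by (simp add: sub_feasible_def)
    finally show ?thesis by (simp add: frob_norm_def)
  qed
  moreover have "frob (shifted C a * ?K) ?K = frob (compressed P C a) ?Y"
    using frob_mult_adjoint_right[OF shifted_carrier[OF C a] Kc Kc]
      frob_congruence[OF shifted_carrier[OF C a] P Yc] KKt
    by (simp add: compressed_def)
  ultimately show ?thesis
    using Kc aE neg unfolding escaping_direction_def by auto
qed

theorem theoremB3:
  fixes n r :: nat and R C P Y :: "real mat" and a :: "real vec" and l1 l2 :: real
  assumes "n \<ge> 1" and "r > 1"
    and "a \<in> E n" and "R = singular_pt r a" and "R \<in> \<B> n r"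
    and "C \<in> sym_mats n"
    and "P \<in> carrier_mat n (n - 1)"
    and "transpose_mat P * P = 1\<^sub>m (n - 1)" and "P * transpose_mat P = centering n"
    and "kkt_solution n P C a Y l1 l2"
  shows "(frob (compressed P C a) Y = 0 \<longrightarrow>
            is_arg_min (\<lambda>X. frob C X) (\<lambda>X. X \<in> sdp_feasible n) (outer a a)) \<and>
         (frob (compressed P C a) Y < 0 \<longrightarrow>
            (\<forall>H \<in> carrier_mat (n - 1) (r - 1). Y = H * transpose_mat H \<longrightarrow>
               escaping_direction n r C R (P * H)))"
proof (intro conjI impI ballI)
  have C: "C \<in> carrier_mat n n" and a: "a \<in> carrier_vec n"
    using assms(3,6) by (auto simp: sym_mats_def E_def)
  note Y_value = kkt_value[OF C a assms(7,10)]
  {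
    assume "frob (compressed P C a) Y = 0"
    then have "l1 = 0" using Y_value assms(1) by simp
    moreover have "compressed P C a \<in> carrier_mat (n - 1) (n - 1)"
      using C a assms(7) by (auto simp: compressed_def)
    then have "compressed P C a - 0 \<cdot>\<^sub>m 1\<^sub>m (n - 1) = compressed P C a"
      by (intro eq_matI) auto
    ultimately have "compressed P C a - l2 \<cdot>\<^sub>m (transpose_mat P * diagm a * P) \<in> psd_mats (n - 1)"
      using assms(10) by (simp add: kkt_solution_def Let_def)
    then show "is_arg_min (\<lambda>X. frob C X) (\<lambda>X. X \<in> sdp_feasible n) (outer a a)"
      using rank_one_sdp_feasible[OF assms(3)] rank_one_optimal[OF assms(3) C assms(7,9)]
      by (auto simp: is_arg_min_def not_less)
  next
    fix H assume "frob (compressed P C a) Y < 0" "H \<in> carrier_mat (n - 1) (r - 1)"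
      "Y = H * transpose_mat H"
    then show "escaping_direction n r C R (P * H)"
      using escaping_direction_of_factor[OF assms(1,3) C assms(7-9)] assms(4,10)
      by (simp add: kkt_solution_def)
  }
qed

end
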